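(* Let $k$ be a field, $n=1$, and let $\xi_0,\xi_1$ be finite multisets in $\mathbb{N}$. Then the orbit space $GL(F(\xi_0))\backslash\mathcal{RF}(\xi_0,\xi_1)$ consists of a finite set of points.
   Context: Here $n=1$ and $A_1=k[x]$ is $\mathbb{N}$-graded with $x^v$ in degree $v$; $0\in\mathbb N$. A multiset in $\mathbb{N}$ is a subset of $\mathbb{N}$ with a multiplicity for each element. For a multiset $\xi$, $F(\xi)=\bigoplus_{v\in\xi}k[x](v)$ (with multiplicity) is the free graded $k[x]$-module with one generator in degree $v$ for each occurrence of $v$ in $\xi$, where $M(v)_u=M_{u-v}$; $F(\xi)_v$ is its degree-$v$ part. $GL(F(\xi_0))$ is the group of degree-preserving $k[x]$-module automorphisms of $F(\xi_0)$. A relation family for $(\xi_0,\xi_1)$ is a collection $\{V_v\}_{v\in\xi_1}$ of $k$-vector spaces (one for each distinct $v$ in $\xi_1$) such that (1) $V_v\subseteq F(\xi_0)_v$; (2) $\dim V_v=\dim F(\xi_1)_v$; (3) if $u,v\in\xi_1$ with $u\le v$, then $x^{v-u}\cdot V_u\subseteq V_v$. The set of all relation families is $\mathcal{RF}(\xi_0,\xi_1)$. The group $GL(F(\xi_0))$ acts on it on the left by $\mu\cdot\{V_v\}=\{\mu(V_v)\}$. *)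

theory Defs
  imports
    "HOL-Algebra.Group_Action"
    "HOL-Computational_Algebra.Polynomial"
    "HOL-Library.Function_Algebras"
    "HOL-Library.Multiset"
begin

text \<open>
  Elements of free modules are written in coordinates: the index \<open>(v, i)\<close> stands for the
  \<open>i\<close>-th occurrence (counting from 0) of \<open>v\<close> in the multiset, so that all modules
  \<open>F(\<xi>)\<close> live in one ambient type.
\<close>

type_synonym 'k coords = "nat \<times> nat \<Rightarrow> 'k poly"

definition pscale :: "'k::field poly \<Rightarrow> 'k coords \<Rightarrow> 'k coords"
  where "pscale p f = (\<lambda>i. p * f i)"

definition kscale :: "'k::field \<Rightarrow> 'k coords \<Rightarrow> 'k coords"
  where "kscale c = pscale [:c:]"

interpretation px: module "pscale :: 'k::field poly \<Rightarrow> 'k coords \<Rightarrow> 'k coords"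
  by standard (auto simp: pscale_def fun_eq_iff algebra_simps)

interpretation kv: vector_space "kscale :: 'k::field \<Rightarrow> 'k coords \<Rightarrow> 'k coords"
  by standard (auto simp: kscale_def pscale_def fun_eq_iff algebra_simps smult_add_left)

definition gens :: "nat multiset \<Rightarrow> (nat \<times> nat) set"
  where "gens \<xi> = {(v, i). i < count \<xi> v}"

definition free_mod :: "nat multiset \<Rightarrow> 'k::field coords set"
  where "free_mod \<xi> = {f. \<forall>i. i \<notin> gens \<xi> \<longrightarrow> f i = 0}"

text \<open>
  The degree-\<open>u\<close> part of the shifted module \<open>k[x](v)\<close>, that is
  \<open>k[x]\<^bsub>u-v\<^esub>\<close>, which is zero when \<open>u < v\<close>.
\<close>

definition shift_deg :: "nat \<Rightarrow> nat \<Rightarrow> 'k::field poly set"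
  where "shift_deg v u = (if v \<le> u then range (\<lambda>c. monom c (u - v)) else {0})"

definition free_deg :: "nat multiset \<Rightarrow> nat \<Rightarrow> 'k::field coords set"
  where "free_deg \<xi> u = {f \<in> free_mod \<xi>. \<forall>(v, i) \<in> gens \<xi>. f (v, i) \<in> shift_deg v u}"

definition graded_aut :: "nat multiset \<Rightarrow> ('k::field coords \<Rightarrow> 'k coords) set"
  where "graded_aut \<xi> = {\<mu> \<in> Bij (free_mod \<xi>).
     (\<forall>f \<in> free_mod \<xi>. \<forall>g \<in> free_mod \<xi>. \<mu> (f + g) = \<mu> f + \<mu> g) \<and>
     (\<forall>p. \<forall>f \<in> free_mod \<xi>. \<mu> (pscale p f) = pscale p (\<mu> f)) \<and>
     (\<forall>u. \<mu> ` free_deg \<xi> u \<subseteq> free_deg \<xi> u)}"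

definition GL :: "nat multiset \<Rightarrow> ('k::field coords \<Rightarrow> 'k coords) monoid"
  where "GL \<xi> = (BijGroup (free_mod \<xi>)) \<lparr>carrier := graded_aut \<xi>\<rparr>"

text \<open>
  A family indexed by the distinct elements of \<open>\<xi>\<^sub>1\<close> is an extensional function on
  \<open>set_mset \<xi>\<^sub>1\<close>. The dimensions below are dimensions of subspaces of the
  finite-dimensional spaces \<open>free_deg \<xi> v\<close>, so the convention that \<^term>\<open>kv.dim\<close> is 0 on
  infinite-dimensional spaces plays no role.
\<close>

definition RF :: "nat multiset \<Rightarrow> nat multiset \<Rightarrow> (nat \<Rightarrow> 'k::field coords set) set"
  where "RF \<xi>\<^sub>0 \<xi>\<^sub>1 = {V \<in> extensional (set_mset \<xi>\<^sub>1).
     (\<forall>v \<in># \<xi>\<^sub>1. kv.subspace (V v) \<and> V v \<subseteq> free_deg \<xi>\<^sub>0 v) \<and>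
     (\<forall>v \<in># \<xi>\<^sub>1. kv.dim (V v) = kv.dim (free_deg \<xi>\<^sub>1 v :: 'k coords set)) \<and>
     (\<forall>u \<in># \<xi>\<^sub>1. \<forall>v \<in># \<xi>\<^sub>1. u \<le> v \<longrightarrow> pscale (monom 1 (v - u)) ` V u \<subseteq> V v)}"

definition RF_action :: "nat multiset \<Rightarrow> nat multiset \<Rightarrow> ('k::field coords \<Rightarrow> 'k coords)
    \<Rightarrow> (nat \<Rightarrow> 'k coords set) \<Rightarrow> (nat \<Rightarrow> 'k coords set)"
  where "RF_action \<xi>\<^sub>0 \<xi>\<^sub>1 \<mu> = (\<lambda>V \<in> RF \<xi>\<^sub>0 \<xi>\<^sub>1. \<lambda>v \<in> set_mset \<xi>\<^sub>1. \<mu> ` V v)"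

subsection \<open>The action is a group action\<close>

lemma pscale_apply [simp]: "pscale p f i = p * f i"
  by (simp add: pscale_def)

lemma free_mod_add: "f \<in> free_mod \<xi> \<Longrightarrow> g \<in> free_mod \<xi> \<Longrightarrow> f + g \<in> free_mod \<xi>"
  by (simp add: free_mod_def)

lemma free_mod_pscale: "f \<in> free_mod \<xi> \<Longrightarrow> pscale p f \<in> free_mod \<xi>"
  by (simp add: free_mod_def)

lemma free_mod_zero: "0 \<in> free_mod \<xi>"
  by (simp add: free_mod_def)

lemma free_deg_sub: "free_deg \<xi> u \<subseteq> free_mod \<xi>"
  by (auto simp: free_deg_def)

text \<open>The homogeneous component of degree \<open>u\<close>.\<close>

definition hcomp :: "nat \<Rightarrow> 'k::field coords \<Rightarrow> 'k coords"
  where "hcomp u f = (\<lambda>(v, i). if v \<le> u then monom (coeff (f (v, i)) (u - v)) (u - v) else 0)"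

lemma hcomp_mem: "f \<in> free_mod \<xi> \<Longrightarrow> hcomp u f \<in> free_deg \<xi> u"
  by (auto simp: hcomp_def free_deg_def free_mod_def shift_deg_def)

lemma hcomp_id:
  assumes "f \<in> free_deg \<xi> u" shows "hcomp u f = f"
proof
  fix x :: "nat \<times> nat"
  obtain v i where x: "x = (v, i)" by force
  show "hcomp u f x = f x"
  proof (cases "(v, i) \<in> gens \<xi>")
    case True
    then have "f (v, i) \<in> shift_deg v u" using assms by (auto simp: free_deg_def)
    then show ?thesis by (auto simp: x hcomp_def shift_deg_def split: if_splits)
  next
    case False
    then have "f (v, i) = 0" using assms by (auto simp: free_deg_def free_mod_def)
    then show ?thesis by (auto simp: x hcomp_def)
  qed
qed

lemma hcomp_other:
  assumes "f \<in> free_deg \<xi> w" "w \<noteq> u" shows "hcomp u f = 0"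
proof
  fix x :: "nat \<times> nat"
  obtain v i where x: "x = (v, i)" by force
  show "hcomp u f x = 0 x"
  proof (cases "(v, i) \<in> gens \<xi>")
    case True
    then have "f (v, i) \<in> shift_deg v w" using assms by (auto simp: free_deg_def)
    then show ?thesis using assms(2)
      by (auto simp: x hcomp_def shift_deg_def split: if_splits)
  next
    case False
    then have "f (v, i) = 0" using assms by (auto simp: free_deg_def free_mod_def)
    then show ?thesis by (auto simp: x hcomp_def)
  qed
qed

lemma hcomp_add: "hcomp u (f + g) = hcomp u f + hcomp u g"
  by (auto simp: hcomp_def fun_eq_iff add_monom)

lemma hcomp_zero: "hcomp u 0 = 0"
  by (auto simp: hcomp_def fun_eq_iff)

lemma hcomp_sum: "finite A \<Longrightarrow> hcomp u (\<Sum>a\<in>A. h a) = (\<Sum>a\<in>A. hcomp u (h a))"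
proof (induction A rule: finite_induct)
  case empty
  show ?case by (simp only: sum.empty hcomp_zero)
next
  case (insert a A)
  then show ?case by (simp only: sum.insert[OF insert.hyps] hcomp_add)
qed

lemma finite_gens: "finite (gens \<xi>)"
proof -
  have "gens \<xi> = (SIGMA v:set_mset \<xi>. {..<count \<xi> v})"
    by (auto simp: gens_def intro: count_inI)
  then show ?thesis by simp
qed

lemma sum_fun_apply: "(\<Sum>a\<in>A. h a) x = (\<Sum>a\<in>A. h a x)"
  for h :: "'a \<Rightarrow> 'b \<Rightarrow> 'c::comm_monoid_add"
  by (induction A rule: infinite_finite_induct) auto

lemma hcomp_decomp:
  assumes f: "f \<in> free_mod \<xi>"
  obtains N where "f = (\<Sum>u\<le>N. hcomp u f)"
proof -
  define N where "N = (\<Sum>x\<in>gens \<xi>. fst x + degree (f x))"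
  have "f (v, i) = (\<Sum>u\<le>N. hcomp u f (v, i))" for v i
  proof (cases "(v, i) \<in> gens \<xi>")
    case False
    then have "f (v, i) = 0" using f by (auto simp: free_mod_def)
    then have "hcomp u f (v, i) = 0" for u by (simp add: hcomp_def)
    then show ?thesis unfolding \<open>f (v, i) = 0\<close> by (simp only: sum.neutral_const)
  next
    case True
    then have "fst (v, i) + degree (f (v, i)) \<le> N"
      unfolding N_def by (intro member_le_sum) (auto simp: finite_gens)
    then have le: "v + degree (f (v, i)) \<le> N" by simp
    have "(\<Sum>u\<le>N. hcomp u f (v, i)) =
        (\<Sum>u\<in>{v..N}. monom (coeff (f (v, i)) (u - v)) (u - v))"
      by (intro sum.mono_neutral_cong_right) (auto simp: hcomp_def)
    also have "\<dots> = (\<Sum>j\<le>N - v. monom (coeff (f (v, i)) j) j)"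
      by (rule sum.reindex_bij_witness[where i = "\<lambda>j. j + v" and j = "\<lambda>u. u - v"])
        (use le in auto)
    also have "\<dots> = f (v, i)"
      by (rule poly_as_sum_of_monoms') (use le in simp)
    finally show ?thesis by (rule sym)
  qed
  then have "f (fst x, snd x) = (\<Sum>u\<le>N. hcomp u f (fst x, snd x))" for x .
  then have "f x = (\<Sum>u\<le>N. hcomp u f) x" for x
    unfolding sum_fun_apply prod.collapse .
  then have "f = (\<Sum>u\<le>N. hcomp u f)" by (rule ext)
  then show ?thesis by (rule that)
qed

lemma graded_autD:
  assumes "\<mu> \<in> graded_aut \<xi>"
  shows "\<mu> \<in> Bij (free_mod \<xi>)" "bij_betw \<mu> (free_mod \<xi>) (free_mod \<xi>)"
    "\<And>f. f \<in> free_mod \<xi> \<Longrightarrow> \<mu> f \<in> free_mod \<xi>"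
    "\<And>f g. f \<in> free_mod \<xi> \<Longrightarrow> g \<in> free_mod \<xi> \<Longrightarrow> \<mu> (f + g) = \<mu> f + \<mu> g"
    "\<And>p f. f \<in> free_mod \<xi> \<Longrightarrow> \<mu> (pscale p f) = pscale p (\<mu> f)"
    "\<And>u f. f \<in> free_deg \<xi> u \<Longrightarrow> \<mu> f \<in> free_deg \<xi> u"
proof -
  show "\<mu> \<in> Bij (free_mod \<xi>)" using assms unfolding graded_aut_def by blast
  then show b: "bij_betw \<mu> (free_mod \<xi>) (free_mod \<xi>)" unfolding Bij_def by blast
  show "\<And>f. f \<in> free_mod \<xi> \<Longrightarrow> \<mu> f \<in> free_mod \<xi>" using bij_betwE[OF b] by blast
qed (use assms in \<open>auto simp: graded_aut_def image_subset_iff\<close>)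

lemma graded_aut_zero:
  assumes "\<mu> \<in> graded_aut \<xi>" shows "\<mu> 0 = 0"
  using graded_autD(4)[OF assms free_mod_zero free_mod_zero] by simp

lemma graded_aut_sum:
  assumes "\<mu> \<in> graded_aut \<xi>" "finite A" "\<And>a. a \<in> A \<Longrightarrow> h a \<in> free_mod \<xi>"
  shows "(\<Sum>a\<in>A. h a) \<in> free_mod \<xi> \<and> \<mu> (\<Sum>a\<in>A. h a) = (\<Sum>a\<in>A. \<mu> (h a))"
  using assms(2,3)
proof (induction A rule: finite_induct)
  case empty
  show ?case using graded_aut_zero[OF assms(1)] free_mod_zero by (simp only: sum.empty simp_thms)
next
  case (insert a A)
  then have "h a \<in> free_mod \<xi>" "sum h A \<in> free_mod \<xi>"
    "\<mu> (sum h A) = (\<Sum>a\<in>A. \<mu> (h a))" by blast+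
  then show ?case
    using graded_autD(4)[OF assms(1), of "h a" "sum h A"] free_mod_add[of "h a" \<xi> "sum h A"]
    by (simp only: sum.insert[OF insert.hyps] simp_thms)
qed

lemma graded_aut_hcomp:
  assumes \<mu>: "\<mu> \<in> graded_aut \<xi>" and f: "f \<in> free_mod \<xi>"
  shows "hcomp u (\<mu> f) = \<mu> (hcomp u f)"
proof -
  obtain N where N: "f = (\<Sum>w\<le>N. hcomp w f)" using hcomp_decomp[OF f] by blast
  have mem: "hcomp w f \<in> free_mod \<xi>" for w
    using hcomp_mem[OF f] free_deg_sub by blast
  have inner: "hcomp u (hcomp w f) = (if w = u then hcomp u f else 0)" for w
    using hcomp_id hcomp_other hcomp_mem[OF f] by metis
  have outer: "hcomp u (\<mu> (hcomp w f)) = (if w = u then \<mu> (hcomp u f) else 0)" for w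
    using hcomp_id hcomp_other graded_autD(6)[OF \<mu> hcomp_mem[OF f]] by metis
  have "\<mu> f = \<mu> (\<Sum>w\<le>N. hcomp w f)" by (rule arg_cong[OF N])
  also have "\<dots> = (\<Sum>w\<le>N. \<mu> (hcomp w f))"
    using graded_aut_sum[OF \<mu>, of "{..N}" "\<lambda>w. hcomp w f"] mem by simp
  finally have "\<mu> f = (\<Sum>w\<le>N. \<mu> (hcomp w f))" .
  then have *: "hcomp u (\<mu> f) = (if u \<le> N then \<mu> (hcomp u f) else 0)"
    by (simp add: hcomp_sum outer sum.delta)
  have "hcomp u f = hcomp u (\<Sum>w\<le>N. hcomp w f)" by (rule arg_cong[OF N])
  then have "hcomp u f = (if u \<le> N then hcomp u f else 0)"
    by (simp add: hcomp_sum inner sum.delta)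
  then show ?thesis using * graded_aut_zero[OF \<mu>] by (auto split: if_splits)
qed

lemma graded_aut_reflects_deg:
  assumes \<mu>: "\<mu> \<in> graded_aut \<xi>" and f: "f \<in> free_mod \<xi>" and "\<mu> f \<in> free_deg \<xi> u"
  shows "f \<in> free_deg \<xi> u"
proof -
  have "\<mu> (hcomp u f) = \<mu> f"
    using graded_aut_hcomp[OF \<mu> f, of u] hcomp_id[OF assms(3)] by simp
  moreover have "hcomp u f \<in> free_mod \<xi>" using hcomp_mem[OF f] free_deg_sub by blast
  ultimately have "hcomp u f = f"
    using graded_autD(2)[OF \<mu>] f by (auto simp: bij_betw_def inj_on_def)
  then show ?thesis using hcomp_mem[OF f, of u] by simp
qed

lemma graded_aut_compose:
  assumes \<mu>: "\<mu> \<in> graded_aut \<xi>" and \<nu>: "\<nu> \<in> graded_aut \<xi>"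
  shows "compose (free_mod \<xi>) \<mu> \<nu> \<in> graded_aut \<xi>"
proof -
  have "compose (free_mod \<xi>) \<mu> \<nu> \<in> Bij (free_mod \<xi>)"
    using compose_Bij graded_autD(1) \<mu> \<nu> by blast
  then show ?thesis
    unfolding graded_aut_def
    by (auto simp: compose_def free_mod_add free_mod_pscale graded_autD[OF \<mu>] graded_autD[OF \<nu>]
        dest: subsetD[OF free_deg_sub])
qed

lemma graded_aut_inv:
  assumes \<mu>: "\<mu> \<in> graded_aut \<xi>"
  shows "(\<lambda>x\<in>free_mod \<xi>. inv_into (free_mod \<xi>) \<mu> x) \<in> graded_aut \<xi>"
proof -
  let ?F = "free_mod \<xi>" and ?\<nu> = "inv_into (free_mod \<xi>) \<mu>"
  note b = graded_autD(2)[OF \<mu>]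
  have cl: "?\<nu> f \<in> ?F" if "f \<in> ?F" for f
    using that b bij_betwE[OF bij_betw_inv_into[OF b]] by blast
  have r: "\<mu> (?\<nu> f) = f" if "f \<in> ?F" for f
    by (rule bij_betw_inv_into_right[OF b that])
  have l: "?\<nu> (\<mu> f) = f" if "f \<in> ?F" for f
    by (rule bij_betw_inv_into_left[OF b that])
  have add: "?\<nu> (f + g) = ?\<nu> f + ?\<nu> g" if "f \<in> ?F" "g \<in> ?F" for f g
    using l[of "?\<nu> f + ?\<nu> g"] graded_autD(4)[OF \<mu>, of "?\<nu> f" "?\<nu> g"] that
    by (simp add: cl r free_mod_add)
  have sc: "?\<nu> (pscale p f) = pscale p (?\<nu> f)" if "f \<in> ?F" for p f
    using l[of "pscale p (?\<nu> f)"] graded_autD(5)[OF \<mu>, of "?\<nu> f" p] that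
    by (simp add: cl r free_mod_pscale)
  have deg: "?\<nu> f \<in> free_deg \<xi> u" if "f \<in> free_deg \<xi> u" for f u
    using graded_aut_reflects_deg[OF \<mu>, of "?\<nu> f" u] that free_deg_sub[of \<xi> u]
    by (auto simp: cl r subset_iff)
  show ?thesis
    using restrict_inv_into_Bij[OF graded_autD(1)[OF \<mu>]]
    unfolding graded_aut_def
    by (auto simp: add sc deg free_mod_add free_mod_pscale dest: subsetD[OF free_deg_sub])
qed

lemma graded_aut_id: "(\<lambda>x\<in>free_mod \<xi>. x) \<in> graded_aut \<xi>"
  unfolding graded_aut_def
  by (auto simp: id_Bij free_mod_add free_mod_pscale dest: subsetD[OF free_deg_sub])

lemma subgroup_graded_aut: "subgroup (graded_aut \<xi>) (BijGroup (free_mod \<xi>))"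
proof (rule group.subgroupI[OF group_BijGroup])
  show "graded_aut \<xi> \<subseteq> carrier (BijGroup (free_mod \<xi>))"
    using graded_autD(1) by (auto simp: BijGroup_def)
  show "graded_aut \<xi> \<noteq> {}" using graded_aut_id by blast
  show "inv\<^bsub>BijGroup (free_mod \<xi>)\<^esub> \<mu> \<in> graded_aut \<xi>" if "\<mu> \<in> graded_aut \<xi>" for \<mu>
    using that graded_aut_inv inv_BijGroup[OF graded_autD(1)[OF that]] by simp
  show "\<mu> \<otimes>\<^bsub>BijGroup (free_mod \<xi>)\<^esub> \<nu> \<in> graded_aut \<xi>"
    if "\<mu> \<in> graded_aut \<xi>" "\<nu> \<in> graded_aut \<xi>" for \<mu> \<nu>
    using graded_aut_compose[OF that] that[THEN graded_autD(1)] by (simp add: BijGroup_def)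
qed

lemma group_GL: "group (GL \<xi>)"
  unfolding GL_def
  by (rule subgroup.subgroup_is_group[OF subgroup_graded_aut group_BijGroup])

lemma GL_simps:
  "carrier (GL \<xi>) = graded_aut \<xi>"
  "\<one>\<^bsub>GL \<xi>\<^esub> = (\<lambda>x\<in>free_mod \<xi>. x)"
  "\<mu> \<in> graded_aut \<xi> \<Longrightarrow> \<nu> \<in> graded_aut \<xi> \<Longrightarrow>
    \<mu> \<otimes>\<^bsub>GL \<xi>\<^esub> \<nu> = compose (free_mod \<xi>) \<mu> \<nu>"
  using graded_autD(1) by (auto simp: GL_def BijGroup_def)

lemma graded_aut_subspace_dim:
  assumes \<mu>: "\<mu> \<in> graded_aut \<xi>" and W: "kv.subspace W" "W \<subseteq> free_mod \<xi>"
  shows "kv.subspace (\<mu> ` W)" "kv.dim (\<mu> ` W) = kv.dim W"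
proof -
  interpret vector_space_pair "kscale :: 'a \<Rightarrow> 'a coords \<Rightarrow> 'a coords" kscale
    by standard
  obtain B where B: "B \<subseteq> W" "kv.independent B" "W \<subseteq> kv.span B" "card B = kv.dim W"
    using kv.basis_exists[of W] by blast
  have sp: "kv.span B = W" using B W by (simp add: kv.span_minimal subset_antisym)
  obtain g where g: "Vector_Spaces.linear kscale kscale g" "\<forall>x\<in>B. g x = \<mu> x"
    using linear_independent_extend[OF B(2)] by blast
  interpret g: Vector_Spaces.linear kscale kscale g by (rule g(1))
  have eq: "\<mu> x = g x" if "x \<in> W" for x
  proof -
    have "x \<in> kv.span B" using that sp by simp
    then have "x \<in> W \<and> \<mu> x = g x"
    proof (induction rule: kv.span_induct_alt)
      case base
      show ?case using graded_aut_zero[OF \<mu>] g.zero kv.subspace_0[OF W(1)] by metis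
    next
      case (step c x y)
      then have "x \<in> W" using B by blast
      then have s: "kscale c x \<in> W" using W kv.subspace_scale by blast
      then have "\<mu> (kscale c x + y) = \<mu> (kscale c x) + \<mu> y"
        using step W graded_autD(4)[OF \<mu>] by blast
      also have "\<mu> (kscale c x) = kscale c (\<mu> x)"
        using graded_autD(5)[OF \<mu>] \<open>x \<in> W\<close> W by (auto simp: kscale_def)
      finally show ?case
        using step s W(1) g(2) g.add[of "kscale c x" y] g.scale[of c x] kv.subspace_add[of W]
        by metis
    qed
    then show ?thesis by simp
  qed
  then have im: "\<mu> ` W = g ` W" by force
  show "kv.subspace (\<mu> ` W)" unfolding im by (rule g.subspace_image[OF W(1)])
  have "inj_on \<mu> W" using graded_autD(2)[OF \<mu>] W(2) by (meson bij_betw_def inj_on_subset)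
  then have inj: "inj_on g (kv.span B)" using eq unfolding sp by (simp add: inj_on_def)
  have "kv.independent (g ` B)" by (rule g.independent_injective_image[OF B(2) inj])
  moreover have "kv.span (g ` B) = g ` W" using g.span_image[of B] sp by simp
  ultimately have "kv.dim (g ` W) = card (g ` B)" by (metis kv.dim_span_eq_card_independent)
  also have "\<dots> = card B" by (rule card_image) (use inj B sp in \<open>auto intro: inj_on_subset\<close>)
  finally show "kv.dim (\<mu> ` W) = kv.dim W" using im B(4) by simp
qed

lemma RF_action_closed:
  assumes \<mu>: "\<mu> \<in> graded_aut \<xi>\<^sub>0" and V: "V \<in> RF \<xi>\<^sub>0 \<xi>\<^sub>1"
  shows "RF_action \<xi>\<^sub>0 \<xi>\<^sub>1 \<mu> V \<in> RF \<xi>\<^sub>0 \<xi>\<^sub>1"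
proof -
  have V1: "kv.subspace (V v)" "V v \<subseteq> free_deg \<xi>\<^sub>0 v" "V v \<subseteq> free_mod \<xi>\<^sub>0"
    "kv.dim (V v) = kv.dim (free_deg \<xi>\<^sub>1 v :: 'a coords set)" if "v \<in># \<xi>\<^sub>1" for v
    using V that free_deg_sub unfolding RF_def by blast+
  have "pscale (monom 1 (v - u)) (\<mu> f) \<in> \<mu> ` V v"
    if "u \<in># \<xi>\<^sub>1" "v \<in># \<xi>\<^sub>1" "u \<le> v" "f \<in> V u" for u v f
  proof -
    have "pscale (monom 1 (v - u)) f \<in> V v" using V that unfolding RF_def by blast
    moreover have "pscale (monom 1 (v - u)) (\<mu> f) = \<mu> (pscale (monom 1 (v - u)) f)"
      using graded_autD(5)[OF \<mu>] V1(3) that by (simp add: subset_iff)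
    ultimately show ?thesis by simp
  qed
  then have "pscale (monom 1 (v - u)) ` \<mu> ` V u \<subseteq> \<mu> ` V v"
    if "u \<in># \<xi>\<^sub>1" "v \<in># \<xi>\<^sub>1" "u \<le> v" for u v
    using that by blast
  moreover have "\<mu> ` V v \<subseteq> free_deg \<xi>\<^sub>0 v" if "v \<in># \<xi>\<^sub>1" for v
    using V1(2)[OF that] graded_autD(6)[OF \<mu>] by blast
  ultimately have "(\<lambda>v\<in>set_mset \<xi>\<^sub>1. \<mu> ` V v) \<in> RF \<xi>\<^sub>0 \<xi>\<^sub>1"
    using graded_aut_subspace_dim[OF \<mu> V1(1,3)] V1(4) unfolding RF_def by simp
  then show ?thesis using V by (simp add: RF_action_def)
qed

lemma RF_action_compose:
  assumes \<mu>: "\<mu> \<in> graded_aut \<xi>\<^sub>0" and \<nu>: "\<nu> \<in> graded_aut \<xi>\<^sub>0" and V: "V \<in> RF \<xi>\<^sub>0 \<xi>\<^sub>1"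
  shows "RF_action \<xi>\<^sub>0 \<xi>\<^sub>1 (compose (free_mod \<xi>\<^sub>0) \<mu> \<nu>) V =
    RF_action \<xi>\<^sub>0 \<xi>\<^sub>1 \<mu> (RF_action \<xi>\<^sub>0 \<xi>\<^sub>1 \<nu> V)"
proof
  fix v
  have "V v \<subseteq> free_mod \<xi>\<^sub>0" if "v \<in># \<xi>\<^sub>1"
    using V that free_deg_sub unfolding RF_def by blast
  then have "compose (free_mod \<xi>\<^sub>0) \<mu> \<nu> ` V v = \<mu> ` \<nu> ` V v" if "v \<in># \<xi>\<^sub>1"
    using that by (force simp: compose_def image_image intro!: image_cong)
  then show "RF_action \<xi>\<^sub>0 \<xi>\<^sub>1 (compose (free_mod \<xi>\<^sub>0) \<mu> \<nu>) V v =
      RF_action \<xi>\<^sub>0 \<xi>\<^sub>1 \<mu> (RF_action \<xi>\<^sub>0 \<xi>\<^sub>1 \<nu> V) v"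
    using V RF_action_closed[OF \<nu> V] by (auto simp: RF_action_def)
qed

lemma RF_action_id:
  assumes V: "V \<in> RF \<xi>\<^sub>0 \<xi>\<^sub>1"
  shows "RF_action \<xi>\<^sub>0 \<xi>\<^sub>1 (\<lambda>x\<in>free_mod \<xi>\<^sub>0. x) V = V"
proof
  fix v
  have "V v \<subseteq> free_mod \<xi>\<^sub>0" if "v \<in># \<xi>\<^sub>1"
    using V that free_deg_sub unfolding RF_def by blast
  then have "(\<lambda>x\<in>free_mod \<xi>\<^sub>0. x) ` V v = V v" if "v \<in># \<xi>\<^sub>1"
    using that by (force simp: subset_iff)
  then show "RF_action \<xi>\<^sub>0 \<xi>\<^sub>1 (\<lambda>x\<in>free_mod \<xi>\<^sub>0. x) V v = V v"
    using V by (auto simp: RF_action_def RF_def extensional_def)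
qed

lemma group_action_RF:
  "group_action (GL \<xi>\<^sub>0) (RF \<xi>\<^sub>0 \<xi>\<^sub>1) (RF_action \<xi>\<^sub>0 \<xi>\<^sub>1)"
proof -
  let ?G = "GL \<xi>\<^sub>0" and ?R = "RF \<xi>\<^sub>0 \<xi>\<^sub>1" and ?a = "RF_action \<xi>\<^sub>0 \<xi>\<^sub>1"
  interpret G: group ?G by (rule group_GL)
  have mult: "?a (\<mu> \<otimes>\<^bsub>?G\<^esub> \<nu>) V = ?a \<mu> (?a \<nu> V)"
    if "\<mu> \<in> carrier ?G" "\<nu> \<in> carrier ?G" "V \<in> ?R" for \<mu> \<nu> V
    using that RF_action_compose by (simp add: GL_simps)
  have one: "?a \<one>\<^bsub>?G\<^esub> V = V" if "V \<in> ?R" for V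
    using that RF_action_id by (simp add: GL_simps)
  have closed: "?a \<mu> V \<in> ?R" if "\<mu> \<in> carrier ?G" "V \<in> ?R" for \<mu> V
    using that RF_action_closed by (simp add: GL_simps)
  have bij: "?a \<mu> \<in> Bij ?R" if \<mu>: "\<mu> \<in> carrier ?G" for \<mu>
  proof -
    have "bij_betw (?a \<mu>) ?R ?R"
    proof (rule bij_betw_byWitness[where f' = "?a (inv\<^bsub>?G\<^esub> \<mu>)"])
      show "\<forall>V\<in>?R. ?a (inv\<^bsub>?G\<^esub> \<mu>) (?a \<mu> V) = V"
        using mult[OF G.inv_closed[OF \<mu>] \<mu>] one G.l_inv[OF \<mu>] by metis
      show "\<forall>V\<in>?R. ?a \<mu> (?a (inv\<^bsub>?G\<^esub> \<mu>) V) = V"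
        using mult[OF \<mu> G.inv_closed[OF \<mu>]] one G.r_inv[OF \<mu>] by metis
    qed (use closed \<mu> in auto)
    then show ?thesis by (auto simp: Bij_def RF_action_def)
  qed
  have hom: "?a (\<mu> \<otimes>\<^bsub>?G\<^esub> \<nu>) = compose ?R (?a \<mu>) (?a \<nu>)"
    if "\<mu> \<in> carrier ?G" "\<nu> \<in> carrier ?G" for \<mu> \<nu>
  proof (rule extensionalityI[where A = ?R])
    show "?a (\<mu> \<otimes>\<^bsub>?G\<^esub> \<nu>) \<in> extensional ?R" by (simp add: RF_action_def)
    show "compose ?R (?a \<mu>) (?a \<nu>) \<in> extensional ?R" by (rule compose_extensional)
    show "?a (\<mu> \<otimes>\<^bsub>?G\<^esub> \<nu>) V = compose ?R (?a \<mu>) (?a \<nu>) V" if "V \<in> ?R" for V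
      using mult \<open>\<mu> \<in> carrier ?G\<close> \<open>\<nu> \<in> carrier ?G\<close> that by (simp add: compose_eq)
  qed
  have "?a \<in> hom ?G (BijGroup ?R)"
    by (rule homI) (simp_all add: BijGroup_def bij hom)
  then show ?thesis
    by (intro group_action.intro group_hom.intro group_hom_axioms.intro group_GL group_BijGroup)
qed

end

theory Submission
  imports Defs "HOL-Library.Product_Lexorder"
begin

text \<open>
  The theorem is an instance of the Bruhat phenomenon: multiplication by \<open>x\<close> is injective, so
  a relation family amounts to a chain of subspaces of one vector space with basis \<open>gens \<xi>\<^sub>0\<close>,
  and graded automorphisms are the linear automorphisms that preserve the filtration of this space
  by degree. A flag can always be brought into coordinate position by a unitriangular change of
  basis, and there are only finitely many coordinate positions.

  Concretely, order the generators lexicographically, so that degrees increase weakly. For a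
  relation family \<open>V\<close> and a generator \<open>g\<close>, consider the homogeneous elements of
  degree \<open>fst g\<close> with leading term \<open>g\<close>, and the indices \<open>a\<close> for which some such
  element is carried into \<open>V a\<close> by a power of \<open>x\<close>. These pairs \<open>(g, a)\<close> are the
  \<open>pivots\<close> of \<open>V\<close>. As \<open>V\<close> is closed under multiplication by \<open>x\<close>, an element
  that works for the smallest such \<open>a\<close> works for all of them (\<open>adapted_element_exists\<close>).
  The elements \<open>b g\<close> chosen in this way form a unitriangular homogeneous basis, hence define
  a graded automorphism \<open>basis_map \<xi>\<^sub>0 b\<close>. Gaussian elimination of leading terms
  (\<open>basis_map_reduction\<close>) shows that this automorphism maps the coordinate family given by the
  pivots onto \<open>V\<close>. So the orbit of \<open>V\<close> depends only on its set of pivots, which is a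
  subset of a fixed finite set.
\<close>

section \<open>Homogeneous elements\<close>

lemma subspace_free_deg: "kv.subspace (free_deg \<xi> u)"
proof (rule kv.subspaceI)
  show "0 \<in> free_deg \<xi> u"
    by (auto simp: free_deg_def free_mod_def shift_deg_def intro!: range_eqI[of _ _ 0])
next
  fix f g :: "'a coords" assume f: "f \<in> free_deg \<xi> u" and g: "g \<in> free_deg \<xi> u"
  then have "f + g = hcomp u (f + g)" by (simp only: hcomp_add hcomp_id)
  then show "f + g \<in> free_deg \<xi> u"
    using hcomp_mem[of "f + g" \<xi> u] free_mod_add f g free_deg_sub by (metis subsetD)
next
  fix c and f :: "'a coords" assume f: "f \<in> free_deg \<xi> u"
  then show "kscale c f \<in> free_deg \<xi> u"
    by (fastforce simp: kscale_def free_deg_def free_mod_def shift_deg_def smult_monom)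
qed

lemma free_deg_coord:
  assumes "f \<in> free_deg \<xi> u" "f g \<noteq> 0"
  obtains c where "g \<in> gens \<xi>" "fst g \<le> u" "c \<noteq> 0" "f g = monom c (u - fst g)"
proof -
  obtain v i where g: "g = (v, i)" by force
  have G: "g \<in> gens \<xi>" using assms unfolding free_deg_def free_mod_def by blast
  then have "f g \<in> shift_deg v u" using assms by (auto simp: free_deg_def g)
  then show ?thesis using assms(2) G that by (auto simp: shift_deg_def g split: if_splits)
qed

lemma pscale_free_deg:
  assumes "p \<in> shift_deg v u" "b \<in> free_deg \<xi> v"
  shows "pscale p b \<in> free_deg \<xi> u"
proof -
  have "p * b (w, j) \<in> shift_deg w u" if "(w, j) \<in> gens \<xi>" for w j
  proof -
    have "b (w, j) \<in> shift_deg w v" using assms(2) that by (auto simp: free_deg_def)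
    then show ?thesis using assms(1)
      by (fastforce simp: shift_deg_def mult_monom image_iff split: if_splits
          intro: range_eqI[of _ _ 0])
  qed
  then show ?thesis using assms(2) by (auto simp: free_deg_def free_mod_def)
qed

lemma pscale_monom: "pscale (monom c n) f = kscale c (pscale (monom 1 n) f)"
  by (simp add: kscale_def pscale_def fun_eq_iff smult_monom flip: mult_smult_left)

lemma pscale_monom_kscale: "pscale (monom 1 n) (kscale c f) = kscale c (pscale (monom 1 n) f)"
  by (simp add: kscale_def pscale_def fun_eq_iff)

text \<open>
  An element of degree \<open>a\<close> that involves only generators of degree at most \<open>v\<close> is
  divisible by \<open>x\<close> to the power \<open>a - v\<close>. This is the step that makes leading terms
  comparable across the different degrees.
\<close>

lemma free_deg_divisible:
  assumes f: "f \<in> free_deg \<xi> a" and le: "v \<le> a" and supp: "\<And>i. f i \<noteq> 0 \<Longrightarrow> fst i \<le> v"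
  obtains h where "h \<in> free_deg \<xi> v" "f = pscale (monom 1 (a - v)) h"
proof -
  define h where "h = (\<lambda>i. if fst i \<le> v then monom (coeff (f i) (a - fst i)) (v - fst i) else 0)"
  have "h \<in> free_deg \<xi> v"
    using f by (auto simp: free_deg_def free_mod_def h_def shift_deg_def)
  moreover have "f i = monom 1 (a - v) * h i" for i
  proof (cases "f i = 0")
    case True
    then show ?thesis by (simp add: h_def)
  next
    case False
    then show ?thesis using supp[OF False] le
      by (elim free_deg_coord[OF f]) (simp add: h_def mult_monom)
  qed
  ultimately show ?thesis using that by (metis ext pscale_apply)
qed

section \<open>Unitriangular homogeneous bases\<close>

definition monic_at :: "nat \<times> nat \<Rightarrow> 'k::field coords \<Rightarrow> bool"
  where "monic_at g b \<longleftrightarrow> b g = 1 \<and> (\<forall>h > g. b h = 0)"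

definition unitriangular :: "nat multiset \<Rightarrow> (nat \<times> nat \<Rightarrow> 'k::field coords) \<Rightarrow> bool"
  where "unitriangular \<xi> b \<longleftrightarrow> (\<forall>g \<in> gens \<xi>. b g \<in> free_deg \<xi> (fst g) \<and> monic_at g (b g))"

definition basis_map :: "nat multiset \<Rightarrow> (nat \<times> nat \<Rightarrow> 'k::field coords) \<Rightarrow> 'k coords \<Rightarrow> 'k coords"
  where "basis_map \<xi> b = (\<lambda>f \<in> free_mod \<xi>. \<Sum>g \<in> gens \<xi>. pscale (f g) (b g))"

lemma basis_map_add:
  "f \<in> free_mod \<xi> \<Longrightarrow> g \<in> free_mod \<xi> \<Longrightarrow>
    basis_map \<xi> b (f + g) = basis_map \<xi> b f + basis_map \<xi> b g"
  by (simp add: basis_map_def free_mod_add px.scale_left_distrib sum.distrib)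

lemma basis_map_pscale:
  "f \<in> free_mod \<xi> \<Longrightarrow> basis_map \<xi> b (pscale p f) = pscale p (basis_map \<xi> b f)"
  by (simp add: basis_map_def free_mod_pscale px.scale_sum_right)

lemma basis_map_zero: "basis_map \<xi> b 0 = 0"
  by (simp add: basis_map_def free_mod_zero)

lemma leading_index:
  assumes "f \<in> free_mod \<xi>" "f \<noteq> 0"
  obtains g where "g \<in> gens \<xi>" "f g \<noteq> 0" "\<And>h. g < h \<Longrightarrow> f h = 0"
proof -
  define S where "S = {i \<in> gens \<xi>. f i \<noteq> 0}"
  have S: "finite S" "S \<noteq> {}"
    using assms finite_gens by (auto simp: S_def free_mod_def fun_eq_iff)
  show ?thesis
  proof (rule that[of "Max S"])
    show "Max S \<in> gens \<xi>" "f (Max S) \<noteq> 0" using Max_in[OF S] by (auto simp: S_def)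
    show "f h = 0" if "Max S < h" for h
    proof -
      have "h \<notin> S" using that Max_ge[OF S(1), of h] by (auto simp del: Max_ge)
      then show ?thesis using assms(1) by (cases h) (auto simp: S_def free_mod_def)
    qed
  qed
qed

lemma basis_map_monomial:
  assumes "g \<in> gens \<xi>"
  shows "(\<lambda>i. if i = g then p else 0) \<in> free_mod \<xi>"
    and "basis_map \<xi> b (\<lambda>i. if i = g then p else 0) = pscale p (b g)"
proof -
  show *: "(\<lambda>i. if i = g then p else 0) \<in> free_mod \<xi>" using assms by (auto simp: free_mod_def)
  have "basis_map \<xi> b (\<lambda>i. if i = g then p else 0) =
      (\<Sum>h\<in>gens \<xi>. if h = g then pscale p (b h) else 0)"
    unfolding basis_map_def restrict_apply'[OF *] by (intro sum.cong) auto
  then show "basis_map \<xi> b (\<lambda>i. if i = g then p else 0) = pscale p (b g)"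
    using assms finite_gens by simp
qed

text \<open>
  Elimination of leading terms: if subtracting the multiple of \<open>b g\<close> that cancels the leading
  term never leaves \<open>X\<close>, and the corresponding coordinate vectors lie in \<open>Y\<close>, then
  every element of \<open>X\<close> is hit from \<open>Y\<close>. It is used with \<open>X\<close> the whole
  module, for surjectivity, and with \<open>X\<close> a member of a relation family.
\<close>

lemma basis_map_reduction:
  assumes b: "unitriangular \<xi> b"
    and X: "X \<subseteq> free_mod \<xi>" and Y: "Y \<subseteq> free_mod \<xi>"
    and Y0: "0 \<in> Y" and Yadd: "\<And>y z. y \<in> Y \<Longrightarrow> z \<in> Y \<Longrightarrow> y + z \<in> Y"
    and step: "\<And>f g. f \<in> X \<Longrightarrow> g \<in> gens \<xi> \<Longrightarrow> f g \<noteq> 0 \<Longrightarrow> (\<And>h. g < h \<Longrightarrow> f h = 0) \<Longrightarrow>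
      f - pscale (f g) (b g) \<in> X \<and> (\<lambda>i. if i = g then f g else 0) \<in> Y"
  shows "X \<subseteq> basis_map \<xi> b ` Y"
proof -
  have main: "f \<in> basis_map \<xi> b ` Y" if "f \<in> X" "\<And>h. f h \<noteq> 0 \<Longrightarrow> h < l" for f l
    using that
  proof (induction l arbitrary: f rule: less_induct)
    case (less l)
    show ?case
    proof (cases "f = 0")
      case True
      then show ?thesis using Y0 basis_map_zero by (metis image_eqI)
    next
      case False
      obtain g where g: "g \<in> gens \<xi>" "f g \<noteq> 0" "\<And>h. g < h \<Longrightarrow> f h = 0"
        using leading_index[of f \<xi>] False less.prems(1) X by blast
      let ?e = "\<lambda>i. if i = g then f g else 0" and ?r = "f - pscale (f g) (b g)"
      have r: "?r \<in> X" and e: "?e \<in> Y" using step[OF less.prems(1) g] by blast+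
      have bg: "b g g = 1" "\<And>h. g < h \<Longrightarrow> b g h = 0"
        using b g(1) by (auto simp: unitriangular_def monic_at_def)
      have "h < g" if "?r h \<noteq> 0" for h
        using that g(3)[of h] bg by (cases h g rule: linorder_cases) auto
      then have "?r \<in> basis_map \<xi> b ` Y"
        using less.IH[of g ?r] less.prems(2)[OF g(2)] r by blast
      then obtain y where y: "y \<in> Y" "?r = basis_map \<xi> b y" by blast
      have "basis_map \<xi> b (y + ?e) = basis_map \<xi> b y + basis_map \<xi> b ?e"
        by (rule basis_map_add[OF subsetD[OF Y y(1)] subsetD[OF Y e]])
      also have "\<dots> = ?r + pscale (f g) (b g)"
        by (simp only: y(2) basis_map_monomial(2)[OF g(1)])
      finally have "basis_map \<xi> b (y + ?e) = ?r + pscale (f g) (b g)" .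
      then have "f = basis_map \<xi> b (y + ?e)" by simp
      then show ?thesis using Yadd[OF y(1) e] by blast
    qed
  qed
  show ?thesis
  proof
    fix f assume f: "f \<in> X"
    \<comment> \<open>a strict upper bound for all generators\<close>
    define l where "l = (Suc (Max (fst ` gens \<xi>)), 0 :: nat)"
    have "h < l" if "f h \<noteq> 0" for h
    proof -
      have "h \<in> gens \<xi>" using that f X unfolding free_mod_def by blast
      then have "fst h \<le> Max (fst ` gens \<xi>)" using finite_gens by (intro Max_ge) auto
      then show ?thesis by (simp add: l_def less_prod_def)
    qed
    then show "f \<in> basis_map \<xi> b ` Y" using main[OF f] by blast
  qed
qed

lemma unitriangularD:
  assumes "unitriangular \<xi> b" "g \<in> gens \<xi>"
  shows "b g \<in> free_deg \<xi> (fst g)" "b g \<in> free_mod \<xi>" "b g g = 1" "g < h \<Longrightarrow> b g h = 0"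
  using assms free_deg_sub unfolding unitriangular_def monic_at_def by blast+

lemma basis_map_mem:
  assumes "unitriangular \<xi> b" "f \<in> free_mod \<xi>"
  shows "basis_map \<xi> b f \<in> free_mod \<xi>"
  using assms unitriangularD(2)[OF assms(1)]
  by (auto simp: basis_map_def free_mod_def sum_fun_apply intro!: sum.neutral)

text \<open>
  The leading coefficient of \<open>f\<close> survives in the image: generators below it contribute
  nothing there, as \<open>b\<close> is triangular, and above it \<open>f\<close> has no coordinates.
\<close>

lemma basis_map_eq_0:
  assumes b: "unitriangular \<xi> b" and f: "f \<in> free_mod \<xi>" and "basis_map \<xi> b f = 0"
  shows "f = 0"
proof (rule ccontr)
  assume "f \<noteq> 0"
  then obtain g where g: "g \<in> gens \<xi>" "f g \<noteq> 0" "\<And>h. g < h \<Longrightarrow> f h = 0"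
    using leading_index[OF f] by blast
  have "f h * b h g = (if h = g then f g else 0)" if "h \<in> gens \<xi>" for h
    using unitriangularD(3,4)[OF b that] g(3)[of h] by (cases h g rule: linorder_cases) auto
  then have "basis_map \<xi> b f g = f g"
    using g(1) finite_gens f by (simp add: basis_map_def sum_fun_apply cong: sum.cong)
  then show False using assms(3) g(2) by simp
qed

lemma basis_map_graded_aut:
  assumes b: "unitriangular \<xi> b"
  shows "basis_map \<xi> b \<in> graded_aut \<xi>"
proof -
  let ?m = "basis_map \<xi> b" and ?F = "free_mod \<xi>"
  have minus: "f - g \<in> ?F" if "f \<in> ?F" "g \<in> ?F" for f g :: "'a coords"
    using that by (simp add: free_mod_def)
  have "inj_on ?m ?F"
  proof (rule inj_onI)
    fix f g assume fg: "f \<in> ?F" "g \<in> ?F" "?m f = ?m g"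
    have "?m f = ?m (f - g) + ?m g"
      using basis_map_add[OF minus[OF fg(1,2)] fg(2), of b] by simp
    then have "f - g = 0" using basis_map_eq_0[OF b minus[OF fg(1,2)]] fg(3) by simp
    then show "f = g" by simp
  qed
  moreover have "?F \<subseteq> ?m ` ?F"
    using unitriangularD(2)[OF b]
    by (intro basis_map_reduction[OF b])
      (auto intro: free_mod_zero free_mod_add minus free_mod_pscale basis_map_monomial)
  ultimately have "?m \<in> Bij ?F"
    using basis_map_mem[OF b] by (auto simp: Bij_def bij_betw_def basis_map_def)
  moreover have "?m f \<in> free_deg \<xi> u" if f: "f \<in> free_deg \<xi> u" for f u
  proof -
    have "pscale (f g) (b g) \<in> free_deg \<xi> u" if "g \<in> gens \<xi>" for g
      using f that unitriangularD(1)[OF b that]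
      by (intro pscale_free_deg[of _ "fst g"]) (auto simp: free_deg_def)
    then have "(\<Sum>g\<in>gens \<xi>. pscale (f g) (b g)) \<in> free_deg \<xi> u"
      by (intro kv.subspace_sum[OF subspace_free_deg])
    then show ?thesis using f free_deg_sub by (auto simp: basis_map_def)
  qed
  ultimately show ?thesis
    unfolding graded_aut_def by (auto simp: basis_map_add basis_map_pscale)
qed

section \<open>Coordinate position of a relation family\<close>

definition pivots :: "nat multiset \<Rightarrow> nat multiset \<Rightarrow> (nat \<Rightarrow> 'k::field coords set)
    \<Rightarrow> ((nat \<times> nat) \<times> nat) set"
  where "pivots \<xi>\<^sub>0 \<xi>\<^sub>1 V = {(g, a). g \<in> gens \<xi>\<^sub>0 \<and> a \<in># \<xi>\<^sub>1 \<and> fst g \<le> a \<and>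
     (\<exists>h \<in> free_deg \<xi>\<^sub>0 (fst g). monic_at g h \<and> pscale (monom 1 (a - fst g)) h \<in> V a)}"

definition coord_family :: "nat multiset \<Rightarrow> nat multiset \<Rightarrow> ((nat \<times> nat) \<times> nat) set
    \<Rightarrow> nat \<Rightarrow> 'k::field coords set"
  where "coord_family \<xi>\<^sub>0 \<xi>\<^sub>1 T =
     (\<lambda>a \<in> set_mset \<xi>\<^sub>1. {f \<in> free_deg \<xi>\<^sub>0 a. \<forall>g. f g \<noteq> 0 \<longrightarrow> (g, a) \<in> T})"

lemma RFD:
  assumes "V \<in> RF \<xi>\<^sub>0 \<xi>\<^sub>1" "a \<in># \<xi>\<^sub>1"
  shows "kv.subspace (V a)" "V a \<subseteq> free_deg \<xi>\<^sub>0 a"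
    "c \<in># \<xi>\<^sub>1 \<Longrightarrow> c \<le> a \<Longrightarrow> f \<in> V c \<Longrightarrow> pscale (monom 1 (a - c)) f \<in> V a"
  using assms unfolding RF_def by blast+

text \<open>
  One element serves for all pivots of a generator at once: an element that enters the family at
  the first possible index stays in it from there on.
\<close>

lemma adapted_element_exists:
  assumes V: "V \<in> RF \<xi>\<^sub>0 \<xi>\<^sub>1" and g: "g \<in> gens \<xi>\<^sub>0"
  shows "\<exists>b \<in> free_deg \<xi>\<^sub>0 (fst g). monic_at g b \<and>
    (\<forall>a. (g, a) \<in> pivots \<xi>\<^sub>0 \<xi>\<^sub>1 V \<longrightarrow> pscale (monom 1 (a - fst g)) b \<in> V a)"
proof (cases "\<exists>a. (g, a) \<in> pivots \<xi>\<^sub>0 \<xi>\<^sub>1 V")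
  case False
  let ?e = "(\<lambda>i. if i = g then 1 else 0) :: 'a coords"
  have "?e \<in> free_deg \<xi>\<^sub>0 (fst g)"
    using g by (auto simp: free_deg_def free_mod_def shift_deg_def intro: range_eqI[of _ _ 0]
        range_eqI[of _ _ 1])
  moreover have "monic_at g ?e" by (auto simp: monic_at_def)
  ultimately show ?thesis using False by blast
next
  case True
  define c where "c = (LEAST a. (g, a) \<in> pivots \<xi>\<^sub>0 \<xi>\<^sub>1 V)"
  have c: "(g, c) \<in> pivots \<xi>\<^sub>0 \<xi>\<^sub>1 V" unfolding c_def using True by (rule LeastI_ex)
  then obtain h where h: "h \<in> free_deg \<xi>\<^sub>0 (fst g)" "monic_at g h"
    "pscale (monom 1 (c - fst g)) h \<in> V c" by (auto simp: pivots_def)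
  have "pscale (monom 1 (a - fst g)) h \<in> V a" if a: "(g, a) \<in> pivots \<xi>\<^sub>0 \<xi>\<^sub>1 V" for a
  proof -
    have le: "c \<le> a" unfolding c_def using a by (rule Least_le)
    have "pscale (monom 1 (a - c)) (pscale (monom 1 (c - fst g)) h) \<in> V a"
      by (rule RFD(3)[OF V _ _ le h(3)]) (use a c in \<open>auto simp: pivots_def\<close>)
    moreover have "monom 1 (a - c) * monom 1 (c - fst g) = (monom 1 (a - fst g) :: 'a poly)"
      using le c by (simp add: mult_monom pivots_def)
    ultimately show ?thesis by (simp only: px.scale_scale)
  qed
  then show ?thesis using h by blast
qed

text \<open>
  Normalising an element of \<open>V a\<close> and dividing it by the appropriate power of \<open>x\<close>
  gives a witness that its leading index is a pivot.
\<close>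

lemma leading_index_pivot:
  assumes V: "V \<in> RF \<xi>\<^sub>0 \<xi>\<^sub>1" and a: "a \<in># \<xi>\<^sub>1" and f: "f \<in> V a"
    and g: "f g \<noteq> 0" "\<And>h. g < h \<Longrightarrow> f h = 0"
  shows "(g, a) \<in> pivots \<xi>\<^sub>0 \<xi>\<^sub>1 V"
proof -
  have fd: "f \<in> free_deg \<xi>\<^sub>0 a" using RFD(2)[OF V a] f by blast
  obtain c where c: "g \<in> gens \<xi>\<^sub>0" "fst g \<le> a" "c \<noteq> 0" "f g = monom c (a - fst g)"
    using free_deg_coord[OF fd g(1)] by blast
  have "fst i \<le> fst g" if "f i \<noteq> 0" for i
    using that g(2)[of i] by (fastforce simp: less_prod_def)
  then obtain h where h: "h \<in> free_deg \<xi>\<^sub>0 (fst g)" "f = pscale (monom 1 (a - fst g)) h"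
    using free_deg_divisible[OF fd c(2)] by blast
  let ?h = "kscale (1 / c) h"
  have "monom 1 (a - fst g) * h g = monom 1 (a - fst g) * [:c:]"
    using c(4) h(2) by (simp add: smult_monom)
  then have "h g = [:c:]" by (rule mult_left_cancel[THEN iffD1, rotated]) simp
  moreover have "h i = 0" if "g < i" for i
    using g(2)[OF that] h(2) by simp
  ultimately have "monic_at g ?h"
    using c(3) by (auto simp: monic_at_def kscale_def one_pCons)
  moreover have "?h \<in> free_deg \<xi>\<^sub>0 (fst g)"
    using h(1) subspace_free_deg kv.subspace_scale by blast
  moreover have "pscale (monom 1 (a - fst g)) ?h \<in> V a"
    using pscale_monom_kscale h(2) kv.subspace_scale[OF RFD(1)[OF V a] f] by metis
  ultimately show ?thesis using a c(1,2) by (auto simp: pivots_def)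
qed

lemma RF_coordinate_position:
  assumes V: "V \<in> RF \<xi>\<^sub>0 \<xi>\<^sub>1"
  obtains \<mu> where "\<mu> \<in> graded_aut \<xi>\<^sub>0"
    "\<And>a. a \<in># \<xi>\<^sub>1 \<Longrightarrow> \<mu> ` coord_family \<xi>\<^sub>0 \<xi>\<^sub>1 (pivots \<xi>\<^sub>0 \<xi>\<^sub>1 V) a = V a"
proof -
  let ?T = "pivots \<xi>\<^sub>0 \<xi>\<^sub>1 V"
  obtain b where b: "\<And>g. g \<in> gens \<xi>\<^sub>0 \<Longrightarrow> b g \<in> free_deg \<xi>\<^sub>0 (fst g) \<and> monic_at g (b g) \<and>
      (\<forall>a. (g, a) \<in> ?T \<longrightarrow> pscale (monom 1 (a - fst g)) (b g) \<in> V a)"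
    using adapted_element_exists[OF V] by metis
  then have u: "unitriangular \<xi>\<^sub>0 b" by (simp add: unitriangular_def)
  have "basis_map \<xi>\<^sub>0 b ` coord_family \<xi>\<^sub>0 \<xi>\<^sub>1 ?T a = V a" if a: "a \<in># \<xi>\<^sub>1" for a
  proof -
    let ?E = "coord_family \<xi>\<^sub>0 \<xi>\<^sub>1 ?T a :: 'a coords set"
    note sub = RFD(1)[OF V a]
    have E: "?E = {f \<in> free_deg \<xi>\<^sub>0 a. \<forall>g. f g \<noteq> 0 \<longrightarrow> (g, a) \<in> ?T}"
      using a by (simp add: coord_family_def)
    have EF: "?E \<subseteq> free_mod \<xi>\<^sub>0" using E free_deg_sub by blast
    have summand: "pscale (f g) (b g) \<in> V a"
      if fd: "f \<in> free_deg \<xi>\<^sub>0 a" and T: "f g \<noteq> 0 \<Longrightarrow> (g, a) \<in> ?T" for f g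
    proof (cases "f g = 0")
      case True
      then show ?thesis using kv.subspace_0[OF sub] by simp
    next
      case False
      then obtain c where c: "g \<in> gens \<xi>\<^sub>0" "f g = monom c (a - fst g)"
        by (rule free_deg_coord[OF fd])
      then have "pscale (monom 1 (a - fst g)) (b g) \<in> V a" using b T[OF False] by blast
      then show ?thesis
        unfolding c(2) pscale_monom[of c] by (rule kv.subspace_scale[OF sub])
    qed
    have "basis_map \<xi>\<^sub>0 b f \<in> V a" if f: "f \<in> ?E" for f
    proof -
      have "(\<Sum>g\<in>gens \<xi>\<^sub>0. pscale (f g) (b g)) \<in> V a"
        using f E by (intro kv.subspace_sum[OF sub] summand) auto
      then show ?thesis using f EF by (auto simp: basis_map_def)
    qed
    moreover have "V a \<subseteq> basis_map \<xi>\<^sub>0 b ` ?E"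
    proof (rule basis_map_reduction[OF u])
      show "V a \<subseteq> free_mod \<xi>\<^sub>0" using RFD(2)[OF V a] free_deg_sub by blast
      show "?E \<subseteq> free_mod \<xi>\<^sub>0" by (rule EF)
      show "0 \<in> ?E" using kv.subspace_0[OF subspace_free_deg] by (simp add: E)
      show "y + z \<in> ?E" if "y \<in> ?E" "z \<in> ?E" for y z
      proof -
        have "y + z \<in> free_deg \<xi>\<^sub>0 a"
          using that E by (intro kv.subspace_add[OF subspace_free_deg]) blast+
        moreover have "(g, a) \<in> ?T" if g: "(y + z) g \<noteq> 0" for g
        proof -
          have "y g \<noteq> 0 \<or> z g \<noteq> 0" using g by auto
          then show ?thesis using \<open>y \<in> ?E\<close> \<open>z \<in> ?E\<close> E by blast
        qed
        ultimately show ?thesis unfolding E by blast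
      qed
      fix f g assume f: "f \<in> V a" and g: "g \<in> gens \<xi>\<^sub>0" "f g \<noteq> 0" "\<And>h. g < h \<Longrightarrow> f h = 0"
      have fd: "f \<in> free_deg \<xi>\<^sub>0 a" using RFD(2)[OF V a] f by blast
      have T: "(g, a) \<in> ?T" by (rule leading_index_pivot[OF V a f g(2,3)])
      have "f - pscale (f g) (b g) \<in> V a"
        by (rule kv.subspace_diff[OF sub f summand[OF fd T]])
      moreover have "(\<lambda>i. if i = g then f g else 0) \<in> ?E"
        using T fd by (auto simp: E free_deg_def free_mod_def shift_deg_def
            intro: range_eqI[of _ _ 0])
      ultimately show "f - pscale (f g) (b g) \<in> V a \<and> (\<lambda>i. if i = g then f g else 0) \<in> ?E" ..
    qed
    ultimately show ?thesis by blast
  qed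
  then show ?thesis using that basis_map_graded_aut[OF u] by blast
qed

section \<open>Finiteness of the orbit space\<close>

lemma coord_family_in_orbit:
  assumes V: "V \<in> RF \<xi>\<^sub>0 \<xi>\<^sub>1"
  shows "coord_family \<xi>\<^sub>0 \<xi>\<^sub>1 (pivots \<xi>\<^sub>0 \<xi>\<^sub>1 V) \<in> orbit (GL \<xi>\<^sub>0) (RF_action \<xi>\<^sub>0 \<xi>\<^sub>1) V"
proof -
  let ?E = "coord_family \<xi>\<^sub>0 \<xi>\<^sub>1 (pivots \<xi>\<^sub>0 \<xi>\<^sub>1 V) :: nat \<Rightarrow> 'a coords set"
  obtain \<mu> where \<mu>: "\<mu> \<in> graded_aut \<xi>\<^sub>0" and im: "\<And>a. a \<in># \<xi>\<^sub>1 \<Longrightarrow> \<mu> ` ?E a = V a"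
    using RF_coordinate_position[OF V] by blast
  let ?\<nu> = "\<lambda>x\<in>free_mod \<xi>\<^sub>0. inv_into (free_mod \<xi>\<^sub>0) \<mu> x"
  have "?\<nu> ` V a = ?E a" if a: "a \<in># \<xi>\<^sub>1" for a
  proof -
    have E: "?E a \<subseteq> free_mod \<xi>\<^sub>0" using a free_deg_sub by (auto simp: coord_family_def)
    have "?\<nu> (\<mu> f) = f" if "f \<in> ?E a" for f
      using that E graded_autD(3)[OF \<mu>] bij_betw_inv_into_left[OF graded_autD(2)[OF \<mu>]] by auto
    then show ?thesis unfolding im[OF a, symmetric] image_image by simp
  qed
  then have "(\<lambda>a \<in> set_mset \<xi>\<^sub>1. ?\<nu> ` V a) = (\<lambda>a \<in> set_mset \<xi>\<^sub>1. ?E a)"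
    by (intro restrict_ext)
  also have "\<dots> = ?E" by (rule extensional_restrict) (simp only: coord_family_def restrict_extensional)
  finally have "?E = (\<lambda>a \<in> set_mset \<xi>\<^sub>1. ?\<nu> ` V a)" by (rule sym)
  then have "?E = RF_action \<xi>\<^sub>0 \<xi>\<^sub>1 ?\<nu> V" using V by (simp add: RF_action_def)
  then show ?thesis
    using graded_aut_inv[OF \<mu>] unfolding orbit_def GL_simps by blast
qed

theorem theorem3p5:
  fixes \<xi>\<^sub>0 \<xi>\<^sub>1 :: "nat multiset"
  shows "finite (orbits (GL \<xi>\<^sub>0) (RF \<xi>\<^sub>0 \<xi>\<^sub>1)
    (RF_action \<xi>\<^sub>0 \<xi>\<^sub>1 :: ('k::field coords \<Rightarrow> 'k coords) \<Rightarrow> _))"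
proof -
  let ?a = "RF_action \<xi>\<^sub>0 \<xi>\<^sub>1 :: ('k coords \<Rightarrow> 'k coords) \<Rightarrow> _"
  let ?R = "RF \<xi>\<^sub>0 \<xi>\<^sub>1 :: (nat \<Rightarrow> 'k coords set) set"
  let ?orb = "orbit (GL \<xi>\<^sub>0) ?a" and ?E = "coord_family \<xi>\<^sub>0 \<xi>\<^sub>1"
  interpret A: group_action "GL \<xi>\<^sub>0" ?R ?a by (rule group_action_RF)
  have closed: "W \<in> ?R" if "V \<in> ?R" "W \<in> ?orb V" for V W
    using that RF_action_closed by (fastforce simp: orbit_def GL_simps)
  have "?orb V \<in> (\<lambda>T. ?orb (?E T)) ` Pow (gens \<xi>\<^sub>0 \<times> set_mset \<xi>\<^sub>1)" if V: "V \<in> ?R" for V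
  proof
    \<comment> \<open>for arbitrary \<open>T\<close> the coordinate family need not be a relation family; for the
      pivots of \<open>V\<close> it is one, because it lies in the orbit of \<open>V\<close>\<close>
    let ?W = "?E (pivots \<xi>\<^sub>0 \<xi>\<^sub>1 V)"
    have W: "?W \<in> ?orb V" by (rule coord_family_in_orbit[OF V])
    have WR: "?W \<in> ?R" by (rule closed[OF V W])
    have "V \<in> ?orb ?W" by (rule A.orbit_sym[OF V WR W])
    then show "?orb V = ?orb ?W"
      using A.orbit_trans V W WR closed by blast
    show "pivots \<xi>\<^sub>0 \<xi>\<^sub>1 V \<in> Pow (gens \<xi>\<^sub>0 \<times> set_mset \<xi>\<^sub>1)" by (auto simp: pivots_def)
  qed
  then have "orbits (GL \<xi>\<^sub>0) ?R ?a \<subseteq> (\<lambda>T. ?orb (?E T)) ` Pow (gens \<xi>\<^sub>0 \<times> set_mset \<xi>\<^sub>1)"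
    by (auto simp: orbits_def)
  moreover have "finite (Pow (gens \<xi>\<^sub>0 \<times> set_mset \<xi>\<^sub>1))" by (simp add: finite_gens)
  ultimately show ?thesis by (meson finite_imageI finite_subset)
qed

end
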